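(* A compact Hausdorff space $X$ is a strong Eberlein compact iff it has a strongly point-finite family $\alpha$ consisting of clopen sets such that $\alpha\cup\{X\setminus V: V\in\alpha\}$ is a subbase of $X$.
   Context: A strong Eberlein compact is a compact space that can be embedded, for some set $\Gamma$, in $\sigma(\mathbb D,\Gamma)=\{x\in\mathbb D^\Gamma: |\{\gamma\in\Gamma: x(\gamma)=1\}|<\aleph_0\}$, where $\mathbb D=\{0,1\}$ is discrete and $\mathbb D^\Gamma$ has the product topology; equivalently, a compact Hausdorff space having a point-finite family $\gamma$ of clopen sets which is $T_0$-separating (for all $x\neq y$ there is $U\in\gamma$ with $|U\cap\{x,y\}|=1$). A family of subsets of a set is strongly point-finite if every subfamily of cardinality $\aleph_0$ contains a finite subfamily with empty intersection. *)

theory Defs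
  imports "HOL-Analysis.Analysis"
begin

definition sigma_cube :: "'i set \<Rightarrow> ('i \<Rightarrow> nat) topology" where
  "sigma_cube \<Gamma> =
     subtopology (product_topology (\<lambda>_. discrete_topology {0, 1}) \<Gamma>)
       {x. finite {\<gamma> \<in> \<Gamma>. x \<gamma> = 1}}"

(* HOL cannot quantify over types inside a formula, so the index sets range over subsets of
   the fixed type 'a set.  The lemma embedding_in_sigma_cube_imp below shows that this loses
   nothing: index sets over any other type give the same class of compact spaces. *)
definition strong_Eberlein_compact :: "'a topology \<Rightarrow> bool" where
  "strong_Eberlein_compact X \<longleftrightarrow>
     compact_space X \<and> (\<exists>(\<Gamma> :: 'a set set) f. embedding_map X (sigma_cube \<Gamma>) f)"

(* Since \<Inter>{} = UNIV is never empty in HOL, the finite subfamily is automatically nonempty. *)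
definition strongly_point_finite :: "'a set set \<Rightarrow> bool" where
  "strongly_point_finite \<alpha> \<longleftrightarrow>
     (\<forall>\<beta> \<subseteq> \<alpha>. infinite \<beta> \<and> countable \<beta> \<longrightarrow> (\<exists>\<F> \<subseteq> \<beta>. finite \<F> \<and> \<Inter>\<F> = {}))"

(* The empty intersection is read as topspace X. *)
definition subbase_of :: "'a topology \<Rightarrow> 'a set set \<Rightarrow> bool" where
  "subbase_of X \<S> \<longleftrightarrow>
     (\<forall>S \<in> \<S>. openin X S) \<and>
     openin X = arbitrary union_of (finite intersection_of (\<lambda>S. S \<in> \<S>) relative_to topspace X)"

lemma Hausdorff_space_sigma_cube: "Hausdorff_space (sigma_cube \<Gamma>)"
  by (simp add: sigma_cube_def Hausdorff_space_subtopology Hausdorff_space_product_topology)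

lemma embedding_in_sigma_cube_imp:
  fixes X :: "'a topology" and \<Gamma> :: "'i set"
  assumes "compact_space X" and f: "embedding_map X (sigma_cube \<Gamma>) f"
  shows "strong_Eberlein_compact X"
proof -
  define U where "U \<gamma> = {x \<in> topspace X. f x \<gamma> = 1}" for \<gamma>
  define \<Delta> where "\<Delta> = U ` \<Gamma>"
  define s where "s = inv_into \<Gamma> U"
  have s: "s V \<in> \<Gamma>" "U (s V) = V" if "V \<in> \<Delta>" for V
    using that by (auto simp: s_def \<Delta>_def inv_into_into f_inv_into_f)
  define g where "g x = restrict (\<lambda>V. f x (s V)) \<Delta>" for x
  have cf: "continuous_map X (sigma_cube \<Gamma>) f"
    using f homeomorphic_imp_continuous_map
    by (fastforce simp: embedding_map_def continuous_map_in_subtopology)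
  have injf: "inj_on f (topspace X)"
    using f by (simp add: embedding_map_def homeomorphic_map_def)
  have comp: "continuous_map X (discrete_topology {0, 1}) (\<lambda>x. f x \<gamma>)" if "\<gamma> \<in> \<Gamma>" for \<gamma>
    using cf that
    by (auto simp: sigma_cube_def continuous_map_in_subtopology continuous_map_componentwise)
  have val: "f x \<gamma> \<in> {0, 1}" if "x \<in> topspace X" "\<gamma> \<in> \<Gamma>" for x \<gamma>
    using continuous_map_funspace[OF comp[OF that(2)]] that(1) by auto
  have ext: "f x \<in> extensional \<Gamma>" and fin: "finite {\<gamma> \<in> \<Gamma>. f x \<gamma> = 1}" if "x \<in> topspace X" for x
    using continuous_map_funspace[OF cf] that by (auto simp: sigma_cube_def PiE_def)
  have fin': "finite {V \<in> \<Delta>. g x V = 1}" if "x \<in> topspace X" for x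
  proof (rule finite_subset)
    show "{V \<in> \<Delta>. g x V = 1} \<subseteq> U ` {\<gamma> \<in> \<Gamma>. f x \<gamma> = 1}"
      using s by (force simp: g_def)
    show "finite (U ` {\<gamma> \<in> \<Gamma>. f x \<gamma> = 1})"
      using fin[OF that] by (rule finite_imageI)
  qed
  have cg: "continuous_map X (sigma_cube \<Delta>) g"
    using comp s fin' unfolding sigma_cube_def
    by (auto simp: continuous_map_in_subtopology continuous_map_componentwise g_def)
  have "inj_on g (topspace X)"
  proof (rule inj_onI)
    fix x y assume xy: "x \<in> topspace X" "y \<in> topspace X" "g x = g y"
    have "f x \<gamma> = f y \<gamma>" if \<gamma>: "\<gamma> \<in> \<Gamma>" for \<gamma>
    proof -
      have D: "U \<gamma> \<in> \<Delta>" using \<gamma> by (simp add: \<Delta>_def)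
      have "f x (s (U \<gamma>)) = f y (s (U \<gamma>))"
        using fun_cong[OF xy(3), of "U \<gamma>"] D by (simp add: g_def)
      hence "x \<in> U (s (U \<gamma>)) \<longleftrightarrow> y \<in> U (s (U \<gamma>))"
        using xy by (simp add: U_def)
      hence "x \<in> U \<gamma> \<longleftrightarrow> y \<in> U \<gamma>" using s(2)[OF D] by simp
      thus ?thesis using val[OF xy(1) \<gamma>] val[OF xy(2) \<gamma>] xy by (auto simp: U_def)
    qed
    hence "f x = f y" using ext xy by (meson extensionalityI)
    thus "x = y" using injf xy by (meson inj_onD)
  qed
  with assms(1) cg have "embedding_map X (sigma_cube \<Delta>) g"
    using Hausdorff_space_sigma_cube continuous_imp_embedding_map by blast
  thus ?thesis using assms(1) by (auto simp: strong_Eberlein_compact_def)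
qed

end

theory Submission
  imports Defs
begin

text \<open>
  By compactness, a family of closed sets is strongly point-finite as soon as it is
  point-finite.  A family of clopen sets and their complements is a subbase of a compact
  Hausdorff space iff the family is \<open>T\<^sub>0\<close>-separating, since a coarser Hausdorff topology agrees
  with the given compact one.
\<close>

text \<open>Infinitely many members through \<open>x\<close> would include a countably infinite
  subfamily, and \<open>x\<close> would survive in every finite intersection taken from it.\<close>

lemma strongly_point_finite_imp_point_finite:
  assumes "strongly_point_finite \<alpha>"
  shows "finite {V \<in> \<alpha>. x \<in> V}"
proof (rule ccontr)
  assume "infinite {V \<in> \<alpha>. x \<in> V}"
  then obtain \<beta> where "\<beta> \<subseteq> {V \<in> \<alpha>. x \<in> V}" "infinite \<beta>" "countable \<beta>"
    using infinite_countable_subset' by metis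
  moreover from this obtain \<F> where "\<F> \<subseteq> \<beta>" "\<Inter>\<F> = {}"
    using assms unfolding strongly_point_finite_def by (metis (lifting) mem_Collect_eq subset_iff)
  ultimately show False by blast
qed

text \<open>If all finite subfamilies of an infinite \<beta> had nonempty intersection, the finite
  intersection property of closed sets would give one point lying in every member of \<beta>,
  against point-finiteness.\<close>

lemma point_finite_imp_strongly_point_finite:
  assumes "compact_space X" and closed: "\<And>V. V \<in> \<alpha> \<Longrightarrow> closedin X V"
    and fin: "\<And>x. x \<in> topspace X \<Longrightarrow> finite {V \<in> \<alpha>. x \<in> V}"
  shows "strongly_point_finite \<alpha>"
  unfolding strongly_point_finite_def
proof (intro allI impI, rule ccontr)
  fix \<beta> assume \<beta>: "\<beta> \<subseteq> \<alpha>" "infinite \<beta> \<and> countable \<beta>"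
    and "\<not> (\<exists>\<F> \<subseteq> \<beta>. finite \<F> \<and> \<Inter>\<F> = {})"
  then have "\<Inter>\<beta> \<noteq> {}"
    using assms(1) closed unfolding compact_space_fip by (metis subsetD)
  then obtain x where x: "\<And>V. V \<in> \<beta> \<Longrightarrow> x \<in> V" by blast
  \<comment> \<open>An infinite \<beta> is nonempty, and any of its members places the common point
    inside \<open>topspace X\<close>, where \<open>fin\<close> applies.\<close>
  obtain V where "V \<in> \<beta>" using \<beta> by fastforce
  then have "x \<in> topspace X"
    using x closed \<beta> closedin_subset by blast
  moreover have "\<beta> \<subseteq> {V \<in> \<alpha>. x \<in> V}" using x \<beta> by blast
  ultimately show False using fin \<beta> finite_subset by blast
qed

text \<open>The sets containing both or neither of two points of the space are stable under
  complements, intersections and unions. If \<alpha> had only such members, so would the whole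
  topology, contrary to the T0 axiom.\<close>

lemma subbase_of_imp_separating:
  assumes "t0_space X" and sb: "subbase_of X (\<alpha> \<union> {topspace X - V | V. V \<in> \<alpha>})"
    and xy: "x \<in> topspace X" "y \<in> topspace X" "x \<noteq> y"
  shows "\<exists>V \<in> \<alpha>. x \<in> V \<longleftrightarrow> y \<notin> V"
proof (rule ccontr)
  assume same: "\<not> (\<exists>V \<in> \<alpha>. x \<in> V \<longleftrightarrow> y \<notin> V)"
  obtain U where U: "openin X U" "x \<in> U \<longleftrightarrow> y \<notin> U"
    using assms(1) xy unfolding t0_space_def by blast
  obtain \<U> where \<U>: "U = \<Union>\<U>"
    "\<And>B. B \<in> \<U> \<Longrightarrow> (finite intersection_of (\<lambda>S. S \<in> \<alpha> \<union> {topspace X - V | V. V \<in> \<alpha>})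
        relative_to topspace X) B"
    using U(1) sb unfolding subbase_of_def union_of_def arbitrary_def by fastforce
  have "x \<in> B \<longleftrightarrow> y \<in> B" if B: "B \<in> \<U>" for B
  proof -
    obtain \<F> where "\<F> \<subseteq> \<alpha> \<union> {topspace X - V | V. V \<in> \<alpha>}" "B = topspace X \<inter> \<Inter>\<F>"
      using \<U>(2)[OF B] unfolding relative_to_def intersection_of_def by (elim exE conjE) blast
    moreover from this have "x \<in> S \<longleftrightarrow> y \<in> S" if "S \<in> \<F>" for S
      using that same xy by auto
    \<comment> \<open>The factor \<open>topspace X\<close> contains both points, which also settles
      the case of an empty \<F>.\<close>
    ultimately show ?thesis using xy by blast
  qed
  then show False using \<U>(1) U(2) by blast
qed

text \<open>The topology \<open>Y\<close> generated by the family is compared with \<open>X\<close>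
  through the identity, a continuous bijection from a compact space onto a Hausdorff one.\<close>

lemma separating_imp_subbase_of:
  assumes "compact_space X"
    and clopen: "\<And>V. V \<in> \<alpha> \<Longrightarrow> openin X V \<and> closedin X V"
    and sep: "\<And>x y. \<lbrakk>x \<in> topspace X; y \<in> topspace X; x \<noteq> y\<rbrakk> \<Longrightarrow> \<exists>V \<in> \<alpha>. x \<in> V \<longleftrightarrow> y \<notin> V"
  shows "subbase_of X (\<alpha> \<union> {topspace X - V | V. V \<in> \<alpha>})"
proof -
  define \<S> where "\<S> = \<alpha> \<union> {topspace X - V | V. V \<in> \<alpha>}"
  define Y where "Y = topology (arbitrary union_of (finite intersection_of (\<lambda>S. S \<in> \<S>)
                        relative_to topspace X))"
  have openY: "openin Y = arbitrary union_of (finite intersection_of (\<lambda>S. S \<in> \<S>)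
                        relative_to topspace X)"
    unfolding Y_def by (rule topology_inverse') (rule istopology_subbase)
  have topY: "topspace Y = topspace X"
    unfolding Y_def by (rule topspace_subbase)
  have openX: "openin X S" if "S \<in> \<S>" for S
    using that clopen unfolding \<S>_def by auto
  have openYS: "openin Y S" if "S \<in> \<S>" for S
  proof -
    \<comment> \<open>Basic open sets of \<open>Y\<close> are cut down to \<open>topspace X\<close>;
      a generator lies inside the space and is unchanged by this.\<close>
    have "topspace X \<inter> S = S" using openin_subset[OF openX[OF that]] by blast
    moreover have "(finite intersection_of (\<lambda>S. S \<in> \<S>)) S"
      using that by (rule finite_intersection_of_inc)
    ultimately have "(finite intersection_of (\<lambda>S. S \<in> \<S>) relative_to topspace X) S"
      unfolding relative_to_def by blast
    then show ?thesis unfolding openY by (rule arbitrary_union_of_inc)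
  qed
  have "Hausdorff_space Y"
    unfolding Hausdorff_space_def topY
  proof (intro allI impI)
    fix x y assume xy: "x \<in> topspace X \<and> y \<in> topspace X \<and> x \<noteq> y"
    then obtain V where V: "V \<in> \<alpha>" "x \<in> V \<longleftrightarrow> y \<notin> V" using sep by blast
    \<comment> \<open>Since complements are generators too, one set that tells the points apart
      yields disjoint neighbourhoods of both.\<close>
    then have *: "openin Y V" "openin Y (topspace X - V)"
      using openYS by (auto simp: \<S>_def)
    then show "\<exists>U V. openin Y U \<and> openin Y V \<and> x \<in> U \<and> y \<in> V \<and> disjnt U V"
    proof (cases "x \<in> V")
      case True
      with V(2) xy have "y \<in> topspace X - V" by blast
      with True * show ?thesis by (meson Diff_disjoint disjnt_def)
    next
      case False
      with V(2) xy have "x \<in> topspace X - V" "y \<in> V" by blast+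
      with * show ?thesis by (meson Diff_disjoint disjnt_def disjnt_sym)
    qed
  qed
  \<comment> \<open>\<open>Y\<close> is the smallest topology on \<open>topspace X\<close> in which
    the members of \<open>\<S>\<close> are open, hence coarser than \<open>X\<close>.\<close>
  moreover have "openin X U" if "openin Y U" for U
    using openX openin_topspace that[unfolded Y_def] by (rule minimal_topology_subbase)
  then have "continuous_map X Y id"
    using topology_finer_continuous_id[of Y X] topY by blast
  ultimately have "homeomorphic_map X Y id"
    using assms(1) topY continuous_imp_homeomorphic_map[of X Y id] by simp
  then have "X = Y" by simp
  then show ?thesis
    unfolding subbase_of_def unfolding \<S>_def[symmetric] using openX openY by simp
qed

text \<open>The family consists of the sets where a coordinate of the embedding equals 1: continuity
  makes them clopen, finite supports make them point-finite, and injectivity makes them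
  separating.\<close>

lemma strong_Eberlein_compact_imp_separating:
  fixes X :: "'a topology"
  assumes "strong_Eberlein_compact X"
  obtains \<alpha> :: "'a set set" where "\<And>V. V \<in> \<alpha> \<Longrightarrow> openin X V \<and> closedin X V"
    and "\<And>x. x \<in> topspace X \<Longrightarrow> finite {V \<in> \<alpha>. x \<in> V}"
    and "\<And>x y. \<lbrakk>x \<in> topspace X; y \<in> topspace X; x \<noteq> y\<rbrakk> \<Longrightarrow> \<exists>V \<in> \<alpha>. x \<in> V \<longleftrightarrow> y \<notin> V"
proof -
  obtain \<Gamma> :: "'a set set" and f where f: "embedding_map X (sigma_cube \<Gamma>) f"
    using assms unfolding strong_Eberlein_compact_def by blast
  define U where "U \<gamma> = {x \<in> topspace X. f x \<gamma> = (1::nat)}" for \<gamma>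
  have cf: "continuous_map X (sigma_cube \<Gamma>) f"
    using f homeomorphic_imp_continuous_map
    by (fastforce simp: embedding_map_def continuous_map_in_subtopology)
  have injf: "inj_on f (topspace X)"
    using f by (simp add: embedding_map_def homeomorphic_map_def)
  have comp: "continuous_map X (discrete_topology {0, 1}) (\<lambda>x. f x \<gamma>)" if "\<gamma> \<in> \<Gamma>" for \<gamma>
    using cf that
    by (auto simp: sigma_cube_def continuous_map_in_subtopology continuous_map_componentwise)
  have val: "f x \<gamma> \<in> {0, 1}" if "x \<in> topspace X" "\<gamma> \<in> \<Gamma>" for x \<gamma>
    using continuous_map_funspace[OF comp[OF that(2)]] that(1) by auto
  have ext: "f x \<in> extensional \<Gamma>" and fin: "finite {\<gamma> \<in> \<Gamma>. f x \<gamma> = 1}" if "x \<in> topspace X" for x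
    using continuous_map_funspace[OF cf] that by (auto simp: sigma_cube_def PiE_def)
  show thesis
  proof
    fix V assume "V \<in> U ` \<Gamma>"
    \<comment> \<open>Membership in \<open>{1}\<close> exhibits \<open>V\<close> as the preimage of
      a clopen set of the discrete space.\<close>
    then obtain \<gamma> where \<gamma>: "\<gamma> \<in> \<Gamma>" "V = {x \<in> topspace X. f x \<gamma> \<in> {1}}"
      by (auto simp: U_def)
    show "openin X V \<and> closedin X V"
      unfolding \<gamma>(2)
      by (intro conjI openin_continuous_map_preimage[OF comp[OF \<gamma>(1)]]
          closedin_continuous_map_preimage[OF comp[OF \<gamma>(1)]]) auto
  next
    fix x assume x: "x \<in> topspace X"
    \<comment> \<open>Several coordinates may give the same set, so the members through
      \<open>x\<close> form an image of the support of \<open>f x\<close>.\<close>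
    have "{V \<in> U ` \<Gamma>. x \<in> V} \<subseteq> U ` {\<gamma> \<in> \<Gamma>. f x \<gamma> = 1}" by (auto simp: U_def)
    then show "finite {V \<in> U ` \<Gamma>. x \<in> V}" using fin[OF x] finite_surj by blast
  next
    fix x y assume xy: "x \<in> topspace X" "y \<in> topspace X" "x \<noteq> y"
    then have "f x \<noteq> f y" using injf by (meson inj_onD)
    \<comment> \<open>Both functions are extensional, so they differ at an index in \<Gamma>; there
      one value is 0 and the other 1.\<close>
    then obtain \<gamma> where "\<gamma> \<in> \<Gamma>" "f x \<gamma> \<noteq> f y \<gamma>"
      using ext xy by (meson extensionalityI)
    then show "\<exists>V \<in> U ` \<Gamma>. x \<in> V \<longleftrightarrow> y \<notin> V"
      using val[OF xy(1)] val[OF xy(2)] xy by (force simp: U_def)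
  qed
qed

text \<open>Each point is sent to the list of its memberships, with \<alpha> itself as index set.
  Separation gives injectivity, and a continuous injection of a compact space into a Hausdorff space
  is an embedding.\<close>

lemma separating_imp_strong_Eberlein_compact:
  assumes "compact_space X"
    and clopen: "\<And>V. V \<in> \<alpha> \<Longrightarrow> openin X V \<and> closedin X V"
    and fin: "\<And>x. x \<in> topspace X \<Longrightarrow> finite {V \<in> \<alpha>. x \<in> V}"
    and sep: "\<And>x y. \<lbrakk>x \<in> topspace X; y \<in> topspace X; x \<noteq> y\<rbrakk> \<Longrightarrow> \<exists>V \<in> \<alpha>. x \<in> V \<longleftrightarrow> y \<notin> V"
  shows "strong_Eberlein_compact X"
proof -
  \<comment> \<open>\<open>restrict\<close> is there because points of the product are extensional
    functions.\<close>
  define f where "f x = restrict (\<lambda>V. of_bool (x \<in> V) :: nat) \<alpha>" for x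
  have "continuous_map X (discrete_topology {0, 1}) (\<lambda>x. of_bool (x \<in> V) :: nat)"
    if V: "V \<in> \<alpha>" for V
    unfolding continuous_map_def
  proof (intro conjI allI impI)
    fix S :: "nat set"
    have "{x \<in> topspace X. of_bool (x \<in> V) \<in> S} =
        (if 1 \<in> S then V else {}) \<union> (if 0 \<in> S then topspace X - V else {})"
      using clopen[OF V] closedin_subset[of X V] by (auto simp: of_bool_def split: if_splits)
    then show "openin X {x \<in> topspace X. of_bool (x \<in> V) \<in> S}"
      using clopen[OF V] by auto
  qed auto
  \<comment> \<open>The support of \<open>f x\<close> is the set of members through
    \<open>x\<close>, so point-finiteness places the image in
    \<open>sigma_cube \<alpha>\<close>.\<close>
  moreover have "{V \<in> \<alpha>. f x V = 1} = {V \<in> \<alpha>. x \<in> V}" for x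
    by (auto simp: f_def)
  ultimately have "continuous_map X (sigma_cube \<alpha>) f"
    using fin unfolding sigma_cube_def
    by (auto simp: continuous_map_in_subtopology continuous_map_componentwise f_def)
  moreover have "inj_on f (topspace X)"
  proof (rule inj_onI, rule ccontr)
    fix x y assume xy: "x \<in> topspace X" "y \<in> topspace X" "f x = f y" "x \<noteq> y"
    then obtain V where "V \<in> \<alpha>" "x \<in> V \<longleftrightarrow> y \<notin> V" using sep by blast
    then show False using fun_cong[OF xy(3), of V] by (auto simp: f_def)
  qed
  ultimately have "embedding_map X (sigma_cube \<alpha>) f"
    using assms(1) Hausdorff_space_sigma_cube continuous_imp_embedding_map by blast
  then show ?thesis
    using assms(1) embedding_in_sigma_cube_imp by blast
qed

theorem fact3p11:
  fixes X :: "'a topology"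
  assumes "compact_space X" and "Hausdorff_space X"
  shows "strong_Eberlein_compact X \<longleftrightarrow>
    (\<exists>\<alpha> :: 'a set set. strongly_point_finite \<alpha> \<and>
       (\<forall>V \<in> \<alpha>. openin X V \<and> closedin X V) \<and>
       subbase_of X (\<alpha> \<union> {topspace X - V | V. V \<in> \<alpha>}))"
    (is "?L \<longleftrightarrow> ?R")
proof
  assume ?L
  then show ?R
  proof (rule strong_Eberlein_compact_imp_separating)
    fix \<alpha> :: "'a set set"
    assume clopen: "\<And>V. V \<in> \<alpha> \<Longrightarrow> openin X V \<and> closedin X V"
      and fin: "\<And>x. x \<in> topspace X \<Longrightarrow> finite {V \<in> \<alpha>. x \<in> V}"
      and sep: "\<And>x y. \<lbrakk>x \<in> topspace X; y \<in> topspace X; x \<noteq> y\<rbrakk> \<Longrightarrow> \<exists>V \<in> \<alpha>. x \<in> V \<longleftrightarrow> y \<notin> V"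
    have "strongly_point_finite \<alpha>"
      using assms(1) conjunct2[OF clopen] fin by (rule point_finite_imp_strongly_point_finite)
    moreover have "subbase_of X (\<alpha> \<union> {topspace X - V | V. V \<in> \<alpha>})"
      using assms(1) clopen sep by (rule separating_imp_subbase_of)
    ultimately show ?R using clopen by blast
  qed
next
  assume ?R
  then obtain \<alpha> where spf: "strongly_point_finite \<alpha>"
    and clopen: "\<And>V. V \<in> \<alpha> \<Longrightarrow> openin X V \<and> closedin X V"
    and sb: "subbase_of X (\<alpha> \<union> {topspace X - V | V. V \<in> \<alpha>})"
    by blast
  show ?L
    using assms(1) clopen strongly_point_finite_imp_point_finite[OF spf]
      subbase_of_imp_separating[OF Hausdorff_imp_t0_space[OF assms(2)] sb]
    by (rule separating_imp_strong_Eberlein_compact)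
qed

end
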